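(* For every $k\ge 1$, $\#\Pi_1^{k}\subsetneq\#\Pi_1^{k+1}$, where for $k=1$ the vocabularies are additionally assumed to contain the built-in constant $\max$.
   Context: Structures: a finite $\sigma$-structure has universe $\{0,\dots,n-1\}$, $n\ge1$; built-in $\le$ (usual order, with $<$ its strict version), $\min=0$, $\max=n-1$, $\mathrm{BIT}(i,j)$ iff the $i$-th bit of $j$ is $1$. $\mathrm{enc}_\sigma(\mathcal{A})$ is the standard binary encoding (non-built-in relations as $0/1$ truth values of all tuples in lexicographic order, non-built-in constants in binary of length $\lceil\log_2 n\rceil$; built-ins not encoded). $\#\Pi_1^{k}$: the class of functions $f:\{0,1\}^*\to\mathbb{N}$ for which there are a vocabulary $\sigma$ containing built-in $\le,\mathrm{BIT},\min$ (and $\max$ in the case $k=1$ of the claim) and a formula $\varphi(F_1,\dots,F_r,x_1,\dots,x_\ell)=\forall y_1\cdots\forall y_m\,\psi$ with $m\le k$ and $\psi$ quantifier-free, free function variables $F_i$ of arity $a_i$ (usable in terms) and free individual variables $x_j$, such that for every $\sigma$-structure $\mathcal{A}$, $f(\mathrm{enc}_\sigma(\mathcal{A}))$ is the number of tuples $(f_1,\dots,f_r,c_1,\dots,c_\ell)$ with $f_i:\mathrm{dom}(\mathcal{A})^{a_i}\to\mathrm{dom}(\mathcal{A})$, $c_j\in\mathrm{dom}(\mathcal{A})$ and $\mathcal{A}\models\varphi(\bar f,\bar c)$. *)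

theory Defs
  imports Complex_Main "HOL-Library.FuncSet" "HOL-Library.Log_Nat"
begin

section \<open>Vocabularies, structures and their binary encoding\<close>

text \<open>
  Every vocabulary contains the built-in symbols for order, BIT and the constant min;
  the flag says whether it also contains the built-in constant max.
  Only the other symbols are listed: \<open>rel_arities \<sigma> ! i\<close> is the arity of the
  \<open>i\<close>-th relation symbol, and \<open>num_consts \<sigma>\<close> is the number of constant symbols.
\<close>

record vocab =
  rel_arities :: "nat list"
  num_consts :: nat
  has_max :: bool

text \<open>Relation symbols have positive arity, as usual.\<close>

definition vocabulary :: "vocab \<Rightarrow> bool" where
  "vocabulary \<sigma> \<longleftrightarrow> (\<forall>a \<in> set (rel_arities \<sigma>). a \<ge> 1)"

text \<open>
  The universe is \<open>{0..<usize A}\<close>. The value of \<open>rel_of A i\<close> is only ever inspected on tuples of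
  the right length over the universe, so it is left unconstrained elsewhere.
\<close>

record fin_struct =
  usize :: nat
  rel_of :: "nat \<Rightarrow> nat list \<Rightarrow> bool"
  const_of :: "nat \<Rightarrow> nat"

definition is_struct :: "vocab \<Rightarrow> fin_struct \<Rightarrow> bool" where
  "is_struct \<sigma> A \<longleftrightarrow> usize A \<ge> 1 \<and> (\<forall>j < num_consts \<sigma>. const_of A j < usize A)"

text \<open>\<open>product_lists\<close> enumerates the tuples in lexicographic order; numbers are written with the
  most significant bit first.\<close>

definition enc_rel :: "fin_struct \<Rightarrow> nat \<Rightarrow> nat \<Rightarrow> bool list" where
  "enc_rel A a i = map (rel_of A i) (product_lists (replicate a [0..<usize A]))"

definition enc_const :: "fin_struct \<Rightarrow> nat \<Rightarrow> bool list" where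
  "enc_const A j = map (bit (const_of A j)) (rev [0..<ceillog2 (usize A)])"

definition enc :: "vocab \<Rightarrow> fin_struct \<Rightarrow> bool list" where
  "enc \<sigma> A =
     concat (map (\<lambda>i. enc_rel A (rel_arities \<sigma> ! i) i) [0..<length (rel_arities \<sigma>)]) @
     concat (map (enc_const A) [0..<num_consts \<sigma>])"


section \<open>First-order formulas with free function variables\<close>

text \<open>\<open>Rel\<close> and \<open>Const\<close> refer to the non-built-in symbols of the vocabulary, \<open>App i\<close> to the
  function variable number \<open>i\<close>. Individual variables, free or bound, are \<open>Var v\<close>.\<close>

datatype tm =
    Var nat
  | MinC
  | MaxC
  | Const nat
  | App nat "tm list"

datatype fm =
    Eq tm tm
  | Le tm tm
  | Bit tm tm
  | Rel nat "tm list"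
  | Neg fm
  | Conj fm fm
  | Disj fm fm
  | All nat fm
  | Ex nat fm

text \<open>\<open>ars\<close> lists the arities of the function variables; \<open>V\<close> is the set of individual variables
  that may occur free.\<close>

fun wf_tm :: "vocab \<Rightarrow> nat list \<Rightarrow> nat set \<Rightarrow> tm \<Rightarrow> bool" where
  "wf_tm \<sigma> ars V (Var v) \<longleftrightarrow> v \<in> V"
| "wf_tm \<sigma> ars V MinC \<longleftrightarrow> True"
| "wf_tm \<sigma> ars V MaxC \<longleftrightarrow> has_max \<sigma>"
| "wf_tm \<sigma> ars V (Const j) \<longleftrightarrow> j < num_consts \<sigma>"
| "wf_tm \<sigma> ars V (App i ts) \<longleftrightarrow>
     i < length ars \<and> length ts = ars ! i \<and> (\<forall>t \<in> set ts. wf_tm \<sigma> ars V t)"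

fun wf_fm :: "vocab \<Rightarrow> nat list \<Rightarrow> nat set \<Rightarrow> fm \<Rightarrow> bool" where
  "wf_fm \<sigma> ars V (Eq s t) \<longleftrightarrow> wf_tm \<sigma> ars V s \<and> wf_tm \<sigma> ars V t"
| "wf_fm \<sigma> ars V (Le s t) \<longleftrightarrow> wf_tm \<sigma> ars V s \<and> wf_tm \<sigma> ars V t"
| "wf_fm \<sigma> ars V (Bit s t) \<longleftrightarrow> wf_tm \<sigma> ars V s \<and> wf_tm \<sigma> ars V t"
| "wf_fm \<sigma> ars V (Rel i ts) \<longleftrightarrow>
     i < length (rel_arities \<sigma>) \<and> length ts = rel_arities \<sigma> ! i \<and> (\<forall>t \<in> set ts. wf_tm \<sigma> ars V t)"
| "wf_fm \<sigma> ars V (Neg \<phi>) \<longleftrightarrow> wf_fm \<sigma> ars V \<phi>"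
| "wf_fm \<sigma> ars V (Conj \<phi> \<psi>) \<longleftrightarrow> wf_fm \<sigma> ars V \<phi> \<and> wf_fm \<sigma> ars V \<psi>"
| "wf_fm \<sigma> ars V (Disj \<phi> \<psi>) \<longleftrightarrow> wf_fm \<sigma> ars V \<phi> \<and> wf_fm \<sigma> ars V \<psi>"
| "wf_fm \<sigma> ars V (All v \<phi>) \<longleftrightarrow> wf_fm \<sigma> ars (insert v V) \<phi>"
| "wf_fm \<sigma> ars V (Ex v \<phi>) \<longleftrightarrow> wf_fm \<sigma> ars (insert v V) \<phi>"

fun quantifier_free :: "fm \<Rightarrow> bool" where
  "quantifier_free (Neg \<phi>) \<longleftrightarrow> quantifier_free \<phi>"
| "quantifier_free (Conj \<phi> \<psi>) \<longleftrightarrow> quantifier_free \<phi> \<and> quantifier_free \<psi>"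
| "quantifier_free (Disj \<phi> \<psi>) \<longleftrightarrow> quantifier_free \<phi> \<and> quantifier_free \<psi>"
| "quantifier_free (All v \<phi>) \<longleftrightarrow> False"
| "quantifier_free (Ex v \<phi>) \<longleftrightarrow> False"
| "quantifier_free _ \<longleftrightarrow> True"

text \<open>Here \<open>F\<close> interprets the function variables and \<open>e\<close> the individual variables.\<close>

fun eval :: "fin_struct \<Rightarrow> (nat \<Rightarrow> nat list \<Rightarrow> nat) \<Rightarrow> (nat \<Rightarrow> nat) \<Rightarrow> tm \<Rightarrow> nat" where
  "eval A F e (Var v) = e v"
| "eval A F e MinC = 0"
| "eval A F e MaxC = usize A - 1"
| "eval A F e (Const j) = const_of A j"
| "eval A F e (App i ts) = F i (map (eval A F e) ts)"

text \<open>\<open>Bit s t\<close> says that bit number \<open>s\<close> of \<open>t\<close> is set, whence the swapped arguments of \<open>bit\<close>.\<close>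

fun sat :: "fin_struct \<Rightarrow> (nat \<Rightarrow> nat list \<Rightarrow> nat) \<Rightarrow> (nat \<Rightarrow> nat) \<Rightarrow> fm \<Rightarrow> bool" where
  "sat A F e (Eq s t) \<longleftrightarrow> eval A F e s = eval A F e t"
| "sat A F e (Le s t) \<longleftrightarrow> eval A F e s \<le> eval A F e t"
| "sat A F e (Bit s t) \<longleftrightarrow> bit (eval A F e t) (eval A F e s)"
| "sat A F e (Rel i ts) \<longleftrightarrow> rel_of A i (map (eval A F e) ts)"
| "sat A F e (Neg \<phi>) \<longleftrightarrow> \<not> sat A F e \<phi>"
| "sat A F e (Conj \<phi> \<psi>) \<longleftrightarrow> sat A F e \<phi> \<and> sat A F e \<psi>"
| "sat A F e (Disj \<phi> \<psi>) \<longleftrightarrow> sat A F e \<phi> \<or> sat A F e \<psi>"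
| "sat A F e (All v \<phi>) \<longleftrightarrow> (\<forall>d < usize A. sat A F (e(v := d)) \<phi>)"
| "sat A F e (Ex v \<phi>) \<longleftrightarrow> (\<exists>d < usize A. sat A F (e(v := d)) \<phi>)"


section \<open>Counting satisfying assignments\<close>

definition tuples :: "nat \<Rightarrow> nat \<Rightarrow> nat list set" where
  "tuples n a = {t. length t = a \<and> set t \<subseteq> {..<n}}"

text \<open>
  A tuple of functions is a list \<open>fs\<close> whose \<open>i\<close>-th entry is an extensional function, so that
  distinct entries differ on the universe. The free individual variables are
  \<open>Var 0, \<dots>, Var (l - 1)\<close>, with values \<open>cs ! 0, \<dots>, cs ! (l - 1)\<close>.
\<close>

definition sat_assignments ::
    "fin_struct \<Rightarrow> nat list \<Rightarrow> nat \<Rightarrow> fm \<Rightarrow> ((nat list \<Rightarrow> nat) list \<times> nat list) set" where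
  "sat_assignments A ars l \<phi> =
     {(fs, cs).
        length fs = length ars \<and>
        (\<forall>i < length ars. fs ! i \<in> tuples (usize A) (ars ! i) \<rightarrow>\<^sub>E {..<usize A}) \<and>
        cs \<in> tuples (usize A) l \<and>
        sat A ((!) fs) ((!) cs) \<phi>}"

text \<open>The cardinality of this set is meaningful:\<close>

lemma finite_sat_assignments: "finite (sat_assignments A ars l \<phi>)"
proof -
  let ?n = "usize A"
  let ?G = "\<Union>i<length ars. tuples ?n (ars ! i) \<rightarrow>\<^sub>E {..<?n}"
  have fin_tuples: "finite (tuples ?n a)" for a
    unfolding tuples_def using finite_lists_length_eq[of "{..<?n}" a]
    by (simp add: conj_commute)
  have "finite ?G"
    by (intro finite_UN_I finite_PiE) (auto simp: fin_tuples)
  then have "finite {fs. set fs \<subseteq> ?G \<and> length fs = length ars}"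
    by (rule finite_lists_length_eq)
  then have "finite ({fs. set fs \<subseteq> ?G \<and> length fs = length ars} \<times> tuples ?n l)"
    using fin_tuples by simp
  moreover have "sat_assignments A ars l \<phi> \<subseteq>
      {fs. set fs \<subseteq> ?G \<and> length fs = length ars} \<times> tuples ?n l"
    unfolding sat_assignments_def by (force simp: in_set_conv_nth)
  ultimately show ?thesis
    by (rule finite_subset[rotated])
qed

text \<open>
  The class of functions counting satisfying assignments of formulas with a prefix of at most
  \<open>k\<close> universal quantifiers. As usual for such classes, a function is compared with the number of
  assignments only on strings that encode structures.
\<close>

definition sharp_Pi1 :: "bool \<Rightarrow> nat \<Rightarrow> (bool list \<Rightarrow> nat) set" where
  "sharp_Pi1 with_max k =
     {f. \<exists>\<sigma> ars l ys \<psi>.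
        vocabulary \<sigma> \<and> has_max \<sigma> = with_max \<and>
        length ys \<le> k \<and> quantifier_free \<psi> \<and>
        wf_fm \<sigma> ars {..<l} (foldr All ys \<psi>) \<and>
        (\<forall>A. is_struct \<sigma> A \<longrightarrow> f (enc \<sigma> A) = card (sat_assignments A ars l (foldr All ys \<psi>)))}"

end

theory Submission
  imports Defs "HOL-Real_Asymp.Real_Asymp"
begin

text \<open>
  The separating function takes the value 0 or 1 on strings of length \<open>n ^ (k + 1)\<close>, according to
  whether all bits are set, and a doubly exponential value on all other strings. It counts the
  assignments of \<open>\<forall>x\<^sub>1 \<dots> x\<^sub>k\<^sub>+\<^sub>1. R x\<^sub>1 \<dots> x\<^sub>k\<^sub>+\<^sub>1\<close>. Suppose that a formula with \<open>k\<close> universal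
  quantifiers, over any vocabulary, defines it too. Counts over a universe of size \<open>n\<close> are only
  singly exponential in a polynomial of \<open>n\<close>, so the encodings must have length a \<open>(k + 1)\<close>-st power
  for almost all \<open>n\<close>. If all arities are at most \<open>k\<close>, the lengths grow too slowly for this.
  Otherwise there are at least \<open>n ^ (k + 1)\<close> tuples, but a satisfying assignment over the structure
  with all bits set inspects only \<open>O(n ^ k)\<close> of them, and so it survives the removal of another
  tuple, although the function drops to 0.
\<close>

section \<open>Length of encodings and its growth in the size of the universe\<close>

lemma set_product_lists_replicate: "set (product_lists (replicate a [0..<n])) = tuples n a"
proof (induction a)
  case 0
  then show ?case by (auto simp: tuples_def)
next
  case (Suc a)
  then show ?case
    by (auto simp: tuples_def length_Suc_conv image_iff)
qed

lemma card_tuples: "card (tuples n a) = n ^ a"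
  using card_lists_length_eq[of "{..<n}" a] by (simp add: tuples_def conj_commute)

lemma finite_tuples: "finite (tuples n a)"
  using finite_lists_length_eq[of "{..<n}" a] by (simp add: tuples_def conj_commute)

text \<open>The length of an encoding depends on the structure only through the size
  \<open>n\<close> of its universe.\<close>

definition enc_length :: "vocab \<Rightarrow> nat \<Rightarrow> nat" where
  "enc_length \<sigma> n = (\<Sum>a\<leftarrow>rel_arities \<sigma>. n ^ a) + num_consts \<sigma> * ceillog2 n"

lemma length_enc_rel: "length (enc_rel A a i) = usize A ^ a"
proof -
  have "foldr (*) (replicate a x) (1::nat) = x ^ a" for x
    by (induction a) auto
  then show ?thesis
    by (simp add: enc_rel_def length_product_lists)
qed

lemma length_enc: "length (enc \<sigma> A) = enc_length \<sigma> (usize A)"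
proof -
  have "map (\<lambda>i. usize A ^ (rel_arities \<sigma> ! i)) [0..<length (rel_arities \<sigma>)]
      = map (\<lambda>a. usize A ^ a) (rel_arities \<sigma>)"
    by (rule nth_equalityI) auto
  then show ?thesis
    by (simp add: enc_def enc_length_def length_concat length_enc_rel o_def enc_const_def
        sum_list_triv)
qed

text \<open>Since arities are positive, a single relation symbol already contributes a strictly
  increasing summand; all other summands are monotone.\<close>

lemma enc_length_strict_mono:
  assumes "vocabulary \<sigma>" "rel_arities \<sigma> \<noteq> []"
  shows "strict_mono (enc_length \<sigma>)"
proof (rule strict_monoI)
  fix m n :: nat
  assume "m < n"
  obtain a as where as: "rel_arities \<sigma> = a # as"
    using assms(2) by (cases "rel_arities \<sigma>") auto
  have "m ^ a < n ^ a"
    using \<open>m < n\<close> assms(1) as by (intro power_strict_mono) (auto simp: vocabulary_def)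
  moreover have "(\<Sum>a\<leftarrow>as. m ^ a) \<le> (\<Sum>a\<leftarrow>as. n ^ a)"
    using \<open>m < n\<close> by (intro sum_list_mono power_mono) auto
  moreover have "ceillog2 m \<le> ceillog2 n"
    using \<open>m < n\<close> by (intro ceillog2_mono) auto
  ultimately show "enc_length \<sigma> m < enc_length \<sigma> n"
    by (simp add: enc_length_def as add_less_le_mono)
qed

lemma enc_length_le:
  assumes "\<forall>a \<in> set (rel_arities \<sigma>). a \<le> k" "n \<ge> 1" "k \<ge> 1"
  shows "enc_length \<sigma> n \<le> (length (rel_arities \<sigma>) + num_consts \<sigma>) * n ^ k"
proof -
  have "(\<Sum>a\<leftarrow>rel_arities \<sigma>. n ^ a) \<le> (\<Sum>a\<leftarrow>rel_arities \<sigma>. n ^ k)"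
    using assms by (intro sum_list_mono power_increasing) auto
  moreover have "ceillog2 n \<le> n ^ k"
  proof -
    have "ceillog2 n \<le> n"
      using assms(2) by (simp add: ceillog2_le_iff less_imp_le)
    also have "\<dots> \<le> n ^ k"
      using assms by (simp add: self_le_power)
    finally show ?thesis .
  qed
  ultimately show ?thesis
    by (simp add: enc_length_def sum_list_triv add_mult_distrib add_mono)
qed

text \<open>If \<open>L n\<close> were a power \<open>b n ^ (k + 1)\<close> for all large
  \<open>n\<close>, then \<open>b\<close> would be strictly increasing along with \<open>L\<close>.
  Hence \<open>b\<close> grows at least linearly and \<open>L\<close> at least like a power of
  degree \<open>k + 1\<close>, against the bound of degree \<open>k\<close>.\<close>

lemma strict_mono_not_power:
  fixes L :: "nat \<Rightarrow> nat"
  assumes "strict_mono L" and "\<And>n. n \<ge> 1 \<Longrightarrow> L n \<le> M * n ^ k"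
  shows "\<exists>n\<ge>n0. \<nexists>b. L n = b ^ (k + 1)"
proof (rule ccontr)
  assume "\<not> ?thesis"
  then obtain b where b: "\<And>n. n \<ge> n0 \<Longrightarrow> L n = b n ^ (k + 1)"
    by metis
  have b_less: "b n < b (Suc n)" if "n \<ge> n0" for n
  proof -
    have "b n ^ (k + 1) < b (Suc n) ^ (k + 1)"
      using that b[of n] b[of "Suc n"] strict_monoD[OF assms(1), of n "Suc n"] by simp
    then show ?thesis
      using power_less_imp_less_base by blast
  qed
  have b_ge: "j \<le> b (n0 + j)" for j
  proof (induction j)
    case (Suc j)
    then show ?case using b_less[of "n0 + j"] by simp
  qed simp
  \<comment> \<open>\<open>j \<ge> n0\<close> gives \<open>n0 + j \<le> 2 * j\<close>, and
    \<open>j > M * 2 ^ k\<close> makes the final inequality strict.\<close>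
  define j where "j = n0 + M * 2 ^ k + 1"
  have "j ^ (k + 1) \<le> L (n0 + j)"
    using b_ge[of j] b[of "n0 + j"] by (simp only: le_add1 power_mono)
  also have "\<dots> \<le> M * (n0 + j) ^ k"
    by (intro assms(2)) (simp add: j_def)
  also have "\<dots> \<le> M * (2 * j) ^ k"
    by (intro mult_left_mono power_mono) (auto simp: j_def)
  also have "\<dots> = (M * 2 ^ k) * j ^ k"
    by (simp add: power_mult_distrib)
  also have "\<dots> < j * j ^ k"
    by (intro mult_strict_right_mono) (auto simp: j_def)
  finally show False by simp
qed

section \<open>Upper bounds on the number of assignments\<close>

lemma card_sat_assignments_le:
  "card (sat_assignments A ars l \<phi>) \<le> usize A ^ ((\<Sum>i<length ars. usize A ^ (ars ! i)) + l)"
proof -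
  let ?n = "usize A" and ?I = "{..<length ars}"
  let ?S = "\<lambda>i. tuples ?n (ars ! i) \<rightarrow>\<^sub>E {..<?n}"
  \<comment> \<open>Reading a list of functions as a function of its index embeds the assignments
    into a dependent product, whose cardinality is known.\<close>
  let ?g = "\<lambda>(fs, cs). (restrict ((!) fs) ?I, cs :: nat list)"
  have inj: "inj_on ?g (sat_assignments A ars l \<phi>)"
  proof (rule inj_onI)
    fix x y
    assume x: "x \<in> sat_assignments A ars l \<phi>" and y: "y \<in> sat_assignments A ars l \<phi>"
      and eq: "?g x = ?g y"
    obtain fs cs gs ds where xy: "x = (fs, cs)" "y = (gs, ds)"
      by (cases x, cases y)
    have len: "length fs = length ars" "length gs = length ars"
      using x y by (auto simp: xy sat_assignments_def)
    have "restrict ((!) fs) ?I i = restrict ((!) gs) ?I i" for i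
      using eq by (simp add: xy)
    from this[of i for i] have "fs ! i = gs ! i" if "i < length ars" for i
      using that by (metis lessThan_iff restrict_apply')
    then have "fs = gs"
      using len by (intro nth_equalityI) auto
    then show "x = y"
      using eq by (simp add: xy)
  qed
  have sub: "?g ` sat_assignments A ars l \<phi> \<subseteq> PiE ?I ?S \<times> tuples ?n l"
    unfolding sat_assignments_def by (clarsimp simp: restrict_PiE_iff)
  have fin: "finite (PiE ?I ?S \<times> tuples ?n l)"
    by (intro finite_cartesian_product finite_PiE) (auto simp: finite_tuples)
  have "card (sat_assignments A ars l \<phi>) \<le> card (PiE ?I ?S \<times> tuples ?n l)"
    using card_inj_on_le[OF inj sub fin] .
  also have "\<dots> = ?n ^ ((\<Sum>i<length ars. ?n ^ (ars ! i)) + l)"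
    by (simp add: card_cartesian_product card_PiE card_tuples finite_tuples power_add power_sum)
  finally show ?thesis .
qed

text \<open>Bounding the base by \<open>n \<le> 2 ^ n\<close> leaves a polynomial in the exponent of
  2, which is eventually below \<open>2 ^ n\<close>.\<close>

lemma count_bound_less_double_exp:
  fixes ars :: "nat list" and l :: nat
  shows "\<exists>N\<ge>1. \<forall>n\<ge>N. n ^ ((\<Sum>i<length ars. n ^ (ars ! i)) + l) < 2 ^ 2 ^ (n::nat)"
proof -
  \<comment> \<open>The largest arity plus one: the extra degree absorbs the factor \<open>n\<close>
    coming from the base \<open>2 ^ n\<close>.\<close>
  define d where "d = Max (insert 0 (set ars)) + 1"
  define C where "C = length ars + l"
  have "eventually (\<lambda>n. C * n ^ d < (2::nat) ^ n) sequentially"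
    by real_asymp
  then obtain N where N: "\<And>n. n \<ge> N \<Longrightarrow> C * n ^ d < 2 ^ n"
    by (auto simp: eventually_sequentially)
  show ?thesis
  proof (intro exI[of _ "max 1 N"] conjI allI impI)
    fix n
    assume "max 1 N \<le> n"
    then have n: "n \<ge> 1" "n \<ge> N" by auto
    have CN: "C * n ^ d < 2 ^ n" using N[OF n(2)] .
    have "(\<Sum>i<length ars. n ^ (ars ! i)) \<le> (\<Sum>i<length ars. n ^ (d - 1))"
      using n(1) by (intro sum_mono power_increasing) (auto simp: d_def)
    then have "(\<Sum>i<length ars. n ^ (ars ! i)) + l \<le> C * n ^ (d - 1)"
      using n(1) by (simp add: C_def add_mult_distrib add_mono)
    then have "n * ((\<Sum>i<length ars. n ^ (ars ! i)) + l) \<le> n * (C * n ^ (d - 1))"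
      by (rule mult_le_mono2)
    also have "\<dots> = C * n ^ d"
      by (simp add: d_def)
    finally have *: "n * ((\<Sum>i<length ars. n ^ (ars ! i)) + l) < 2 ^ n"
      using CN by simp
    have "n ^ ((\<Sum>i<length ars. n ^ (ars ! i)) + l) \<le> (2 ^ n) ^ ((\<Sum>i<length ars. n ^ (ars ! i)) + l)"
      by (intro power_mono) (auto intro: less_imp_le)
    also have "\<dots> < 2 ^ 2 ^ n"
      using * by (simp flip: power_mult)
    finally show "n ^ ((\<Sum>i<length ars. n ^ (ars ! i)) + l) < 2 ^ 2 ^ n" .
  qed simp
qed

section \<open>The part of a structure that a universal prefix inspects\<close>

text \<open>These are the assignments reached by the prefix \<open>ys\<close>, so that a block of
  quantifiers becomes one quantification over a set that can be counted.\<close>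

definition variants :: "nat \<Rightarrow> nat list \<Rightarrow> (nat \<Rightarrow> nat) \<Rightarrow> (nat \<Rightarrow> nat) set" where
  "variants n ys e = {e'. \<forall>v. if v \<in> set ys then e' v < n else e' v = e v}"

lemma variants_Nil: "variants n [] e = {e}"
  by (auto simp: variants_def)

lemma variants_Cons: "variants n (y # ys) e = (\<Union>d<n. variants n ys (e(y := d)))"
proof (intro equalityI subsetI)
  fix e'
  assume "e' \<in> variants n (y # ys) e"
  then have "e' y < n" "e' \<in> variants n ys (e(y := e' y))"
    unfolding variants_def by fastforce+
  then show "e' \<in> (\<Union>d<n. variants n ys (e(y := d)))"
    by blast
next
  fix e'
  assume "e' \<in> (\<Union>d<n. variants n ys (e(y := d)))"
  then show "e' \<in> variants n (y # ys) e"
    unfolding variants_def by (fastforce split: if_splits)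
qed

lemma sat_foldr_All:
  "sat A F e (foldr All ys \<psi>) \<longleftrightarrow> (\<forall>e' \<in> variants (usize A) ys e. sat A F e' \<psi>)"
  by (induction ys arbitrary: e) (auto simp: variants_Nil variants_Cons)

text \<open>Only an inequality holds in general, because \<open>ys\<close> may repeat
  variables.\<close>

lemma card_variants_le: "finite (variants n ys e) \<and> card (variants n ys e) \<le> n ^ length ys"
proof (induction ys arbitrary: e)
  case (Cons y ys)
  have "card (\<Union>d<n. variants n ys (e(y := d))) \<le> (\<Sum>d<n. card (variants n ys (e(y := d))))"
    by (rule card_UN_le) simp
  also have "\<dots> \<le> (\<Sum>d<n. n ^ length ys)"
    using Cons by (intro sum_mono) auto
  finally show ?case
    using Cons by (simp add: variants_Cons)
qed (simp add: variants_Nil)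

fun rel_atoms :: "fm \<Rightarrow> (nat \<times> tm list) set" where
  "rel_atoms (Rel i ts) = {(i, ts)}"
| "rel_atoms (Neg \<phi>) = rel_atoms \<phi>"
| "rel_atoms (Conj \<phi> \<psi>) = rel_atoms \<phi> \<union> rel_atoms \<psi>"
| "rel_atoms (Disj \<phi> \<psi>) = rel_atoms \<phi> \<union> rel_atoms \<psi>"
| "rel_atoms (All v \<phi>) = rel_atoms \<phi>"
| "rel_atoms (Ex v \<phi>) = rel_atoms \<phi>"
| "rel_atoms _ = {}"

lemma finite_rel_atoms: "finite (rel_atoms \<phi>)"
  by (induction \<phi>) auto

lemma eval_rel_of_update: "eval (A\<lparr>rel_of := R\<rparr>) F e t = eval A F e t"
  by (induction t) (auto cong: map_cong)

text \<open>Terms do not depend on the relations, and without quantifiers each relational atom is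
  looked up at a single tuple.\<close>

lemma sat_rel_of_update:
  assumes "quantifier_free \<phi>"
    and "\<forall>(i, ts) \<in> rel_atoms \<phi>. R i (map (eval A F e) ts) = rel_of A i (map (eval A F e) ts)"
  shows "sat (A\<lparr>rel_of := R\<rparr>) F e \<phi> \<longleftrightarrow> sat A F e \<phi>"
  using assms by (induction \<phi>) (auto simp: eval_rel_of_update cong: map_cong)

lemma sat_assignments_rel_of_update:
  assumes qf: "quantifier_free \<psi>"
    and fscs: "(fs, cs) \<in> sat_assignments A ars l (foldr All ys \<psi>)"
    and R: "\<And>e i ts. e \<in> variants (usize A) ys ((!) cs) \<Longrightarrow> (i, ts) \<in> rel_atoms \<psi> \<Longrightarrow>
      R i (map (eval A ((!) fs) e) ts) = rel_of A i (map (eval A ((!) fs) e) ts)"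
  shows "(fs, cs) \<in> sat_assignments (A\<lparr>rel_of := R\<rparr>) ars l (foldr All ys \<psi>)"
proof -
  have "sat (A\<lparr>rel_of := R\<rparr>) ((!) fs) e \<psi> \<longleftrightarrow> sat A ((!) fs) e \<psi>"
    if "e \<in> variants (usize A) ys ((!) cs)" for e
    using R[OF that] by (intro sat_rel_of_update[OF qf]) auto
  then show ?thesis
    using fscs by (auto simp: sat_assignments_def sat_foldr_All)
qed

section \<open>The structure with all bits set and the separating function\<close>

definition all_ones :: "nat \<Rightarrow> fin_struct" where
  "all_ones n = \<lparr>usize = n, rel_of = (\<lambda>_ _. True), const_of = (\<lambda>_. n - 1)\<rparr>"

lemma all_ones_simps [simp]:
  "usize (all_ones n) = n" "rel_of (all_ones n) i t" "const_of (all_ones n) j = n - 1"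
  by (simp_all add: all_ones_def)

lemma is_struct_all_ones: "n \<ge> 1 \<Longrightarrow> is_struct \<sigma> (all_ones n)"
  by (simp add: is_struct_def)

text \<open>The power of two matters for the constants: they are written with exactly
  \<open>p\<close> bits, and \<open>2 ^ p - 1\<close> has all of these set.\<close>

lemma enc_all_ones: "False \<notin> set (enc \<sigma> (all_ones (2 ^ p)))"
proof -
  have "bit (2 ^ p - 1 :: nat) x" if "x < p" for x
    using that unfolding mask_eq_exp_minus_1[symmetric] by (simp add: bit_mask_iff)
  then show ?thesis
    by (auto simp: enc_def enc_rel_def enc_const_def)
qed

lemma False_in_enc:
  assumes "i < length (rel_arities \<sigma>)" "t \<in> tuples (usize A) (rel_arities \<sigma> ! i)" "\<not> rel_of A i t"
  shows "False \<in> set (enc \<sigma> A)"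
proof -
  have "False \<in> set (enc_rel A (rel_arities \<sigma> ! i) i)"
    using assms(2,3) unfolding enc_rel_def set_map set_product_lists_replicate by (auto simp: image_iff)
  then show ?thesis
    using assms(1) by (auto simp: enc_def)
qed

text \<open>As \<open>n \<ge> 1\<close> is required, the empty string has value 2. This rules out vocabularies without
  relation symbols, since over a universe of size 1 every count is at most 1.\<close>

definition sep_fun :: "nat \<Rightarrow> bool list \<Rightarrow> nat" where
  "sep_fun k w = (if \<exists>n\<ge>1. length w = n ^ (k + 1) then of_bool (False \<notin> set w) else 2 ^ 2 ^ length w)"

lemma sep_fun_in: "sep_fun k \<in> sharp_Pi1 b (k + 1)"
proof -
  define \<sigma> where "\<sigma> = \<lparr>rel_arities = [k + 1], num_consts = 0, has_max = b\<rparr>"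
  define \<psi> where "\<psi> = Rel 0 (map Var [0..<k + 1])"
  let ?\<phi> = "foldr All [0..<k + 1] \<psi>"
  have wf: "wf_fm \<sigma> [] V (foldr All ys \<phi>) \<longleftrightarrow> wf_fm \<sigma> [] (V \<union> set ys) \<phi>" for V ys \<phi>
    by (induction ys arbitrary: V) auto
  have "sep_fun k (enc \<sigma> A) = card (sat_assignments A [] 0 ?\<phi>)" if A: "is_struct \<sigma> A" for A
  proof -
    let ?n = "usize A"
    have n: "?n \<ge> 1" using A by (simp add: is_struct_def)
    have "length (enc \<sigma> A) = ?n ^ (k + 1)"
      by (simp add: length_enc enc_length_def \<sigma>_def)
    then have "\<exists>m\<ge>1. length (enc \<sigma> A) = m ^ (k + 1)"
      using n by blast
    then have sep: "sep_fun k (enc \<sigma> A) = of_bool (False \<notin> set (enc \<sigma> A))"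
      unfolding sep_fun_def by (rule if_P)
    have enc: "False \<notin> set (enc \<sigma> A) \<longleftrightarrow> (\<forall>t \<in> tuples ?n (k + 1). rel_of A 0 t)"
      by (auto simp: enc_def enc_rel_def \<sigma>_def set_product_lists_replicate simp del: replicate_Suc product_lists.simps)
    have "sat A F e ?\<phi> \<longleftrightarrow> (\<forall>t \<in> tuples ?n (k + 1). rel_of A 0 t)" for F e
    proof -
      \<comment> \<open>The values of the quantified variables run through all tuples, so the
        formula says that the relation is full.\<close>
      have surj: "(\<lambda>e'. map e' [0..<k + 1]) ` variants ?n [0..<k + 1] e = tuples ?n (k + 1)"
      proof (intro equalityI subsetI)
        fix t
        assume t: "t \<in> tuples ?n (k + 1)"
        let ?e = "\<lambda>v. if v < k + 1 then t ! v else e v"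
        have "t = map ?e [0..<k + 1]"
          using t by (intro nth_equalityI) (auto simp: tuples_def simp del: upt_Suc)
        moreover have "?e \<in> variants ?n [0..<k + 1] e"
          using t by (auto simp: variants_def tuples_def subset_iff simp del: upt_Suc)
        ultimately show "t \<in> (\<lambda>e'. map e' [0..<k + 1]) ` variants ?n [0..<k + 1] e"
          by blast
      qed (auto simp: variants_def tuples_def simp del: upt_Suc)
      have atom: "sat A F e' \<psi> \<longleftrightarrow> rel_of A 0 (map e' [0..<k + 1])" for e'
        by (simp add: \<psi>_def o_def del: upt_Suc)
      show ?thesis
        by (simp only: sat_foldr_All atom surj[symmetric] ball_simps)
    qed
    \<comment> \<open>With no function variables and no free individual variables, the pair of empty
      lists is the only candidate.\<close>
    then have "sat_assignments A [] 0 ?\<phi> = (if False \<notin> set (enc \<sigma> A) then {([], [])} else {})"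
      unfolding enc by (auto simp: sat_assignments_def tuples_def simp del: upt_Suc)
    then show ?thesis
      using sep by simp
  qed
  moreover have "wf_fm \<sigma> [] {..<0} ?\<phi>"
    unfolding wf by (auto simp: \<psi>_def \<sigma>_def)
  moreover have "vocabulary \<sigma>" "has_max \<sigma> = b" "length [0..<k + 1] \<le> k + 1" "quantifier_free \<psi>"
    by (simp_all add: vocabulary_def \<sigma>_def \<psi>_def)
  ultimately show ?thesis
    unfolding sharp_Pi1_def by blast
qed

lemma sep_fun_notin:
  assumes "k \<ge> 1"
  shows "sep_fun k \<notin> sharp_Pi1 b k"
proof
  assume "sep_fun k \<in> sharp_Pi1 b k"
  then obtain \<sigma> ars l ys \<psi> where voc: "vocabulary \<sigma>" and ys: "length ys \<le> k"
    and qf: "quantifier_free \<psi>"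
    and eq: "\<And>A. is_struct \<sigma> A \<Longrightarrow>
      sep_fun k (enc \<sigma> A) = card (sat_assignments A ars l (foldr All ys \<psi>))"
    unfolding sharp_Pi1_def by blast
  have nonempty: "rel_arities \<sigma> \<noteq> []"
  proof
    assume "rel_arities \<sigma> = []"
    then have "length (enc \<sigma> (all_ones 1)) = 0"
      by (simp add: length_enc enc_length_def)
    then have "sep_fun k (enc \<sigma> (all_ones 1)) = 2"
      by (simp add: sep_fun_def)
    then show False
      using eq[OF is_struct_all_ones[of 1]] card_sat_assignments_le[of "all_ones 1" ars l "foldr All ys \<psi>"]
      by simp
  qed
  note mono = enc_length_strict_mono[OF voc nonempty]
  obtain N where N: "N \<ge> 1"
    "\<And>n. n \<ge> N \<Longrightarrow> n ^ ((\<Sum>i<length ars. n ^ (ars ! i)) + l) < 2 ^ 2 ^ n"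
    using count_bound_less_double_exp[of ars l] by blast
  have power: "\<exists>b\<ge>1. enc_length \<sigma> n = b ^ (k + 1)" if "n \<ge> N" for n
  proof (rule ccontr)
    assume *: "\<not> ?thesis"
    have n1: "n \<ge> 1" using that N(1) by simp
    let ?A = "all_ones n"
    \<comment> \<open>A strictly increasing length satisfies
      \<open>n \<le> enc_length \<sigma> n\<close>.\<close>
    have "(2::nat) ^ 2 ^ n \<le> 2 ^ 2 ^ enc_length \<sigma> n"
      using strict_mono_imp_increasing[OF mono, of n] by simp
    also have "\<dots> = sep_fun k (enc \<sigma> ?A)"
      using * by (auto simp: sep_fun_def length_enc)
    also have "\<dots> \<le> n ^ ((\<Sum>i<length ars. n ^ (ars ! i)) + l)"
      using eq[OF is_struct_all_ones[OF n1]] card_sat_assignments_le[of ?A ars l "foldr All ys \<psi>"]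
      by simp
    finally show False using N(2)[OF that] by simp
  qed
  have "\<exists>a \<in> set (rel_arities \<sigma>). a \<ge> k + 1"
  proof (rule ccontr)
    assume "\<not> ?thesis"
    then have "\<forall>a \<in> set (rel_arities \<sigma>). a \<le> k" by auto
    from strict_mono_not_power[OF mono enc_length_le[OF this _ assms], of N] power
    show False by blast
  qed
  then obtain i where i: "i < length (rel_arities \<sigma>)" "rel_arities \<sigma> ! i \<ge> k + 1"
    by (metis in_set_conv_nth)
  \<comment> \<open>As \<open>p < 2 ^ p\<close>, the universe size \<open>2 ^ p\<close> exceeds both
    \<open>N\<close> and the number of atoms; being a power of two, it makes every encoded bit of
    \<open>?A\<close> equal to 1.\<close>
  define p where "p = N + card (rel_atoms \<psi>)"
  define n :: nat where "n = 2 ^ p"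
  let ?A = "all_ones n"
  have "p < n"
    by (simp add: n_def)
  then have n: "n \<ge> N" "n > card (rel_atoms \<psi>)" "n \<ge> 1"
    by (simp_all add: p_def)
  obtain b where b: "b \<ge> 1" "enc_length \<sigma> n = b ^ (k + 1)"
    using power[OF n(1)] by blast
  \<comment> \<open>All structures of size \<open>n\<close> have encodings of this same length, so
    changing relations stays in the 0/1 case.\<close>
  have sep: "sep_fun k (enc \<sigma> B) = of_bool (False \<notin> set (enc \<sigma> B))" if "usize B = n" for B
    using that b by (auto simp: sep_fun_def length_enc)
  have "card (sat_assignments ?A ars l (foldr All ys \<psi>)) = 1"
    using eq[OF is_struct_all_ones[OF n(3)]] sep[of ?A] enc_all_ones[of \<sigma> p] by (simp add: n_def)
  then obtain fs cs where fscs: "(fs, cs) \<in> sat_assignments ?A ars l (foldr All ys \<psi>)"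
    by (metis card_1_singletonE insertI1 surj_pair)
  \<comment> \<open>The pairs of relation symbol and tuple inspected under the fixed assignment: at
    most one for each atom and each of the at most \<open>n ^ k\<close> variants.\<close>
  define T where "T = (\<lambda>(e, j, ts). (j, map (eval ?A ((!) fs) e) ts)) `
    (variants n ys ((!) cs) \<times> rel_atoms \<psi>)"
  have "card T \<le> card (variants n ys ((!) cs) \<times> rel_atoms \<psi>)"
    unfolding T_def by (intro card_image_le finite_cartesian_product)
      (auto simp: card_variants_le finite_rel_atoms)
  also have "\<dots> \<le> n ^ k * card (rel_atoms \<psi>)"
    using card_variants_le[of n ys "(!) cs"] power_increasing[OF ys n(3)]
    by (simp add: card_cartesian_product)
  also have "\<dots> < n ^ k * n"
    using n by simp
  also have "\<dots> \<le> n ^ (rel_arities \<sigma> ! i)"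
    using power_increasing[OF i(2) n(3)] by (simp add: mult.commute)
  also have "\<dots> = card (Pair i ` tuples n (rel_arities \<sigma> ! i))"
    by (simp add: card_image inj_on_def card_tuples)
  finally have "\<not> Pair i ` tuples n (rel_arities \<sigma> ! i) \<subseteq> T"
    using card_mono[of T] by (auto simp: T_def card_variants_le finite_rel_atoms not_less[symmetric])
  then obtain t where t: "t \<in> tuples n (rel_arities \<sigma> ! i)" "(i, t) \<notin> T"
    by blast
  \<comment> \<open>Only the uninspected tuple \<open>t\<close> is removed, from relation
    \<open>i\<close>. The assignment survives while \<open>sep_fun k\<close> drops to 0.\<close>
  define R where "R = (\<lambda>j s. (j, s) \<noteq> (i, t))"
  let ?B = "?A\<lparr>rel_of := R\<rparr>"
  have "(fs, cs) \<in> sat_assignments ?B ars l (foldr All ys \<psi>)"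
  proof (rule sat_assignments_rel_of_update[OF qf fscs])
    fix e j ts
    assume "e \<in> variants (usize ?A) ys ((!) cs)" "(j, ts) \<in> rel_atoms \<psi>"
    then have "(j, map (eval ?A ((!) fs) e) ts) \<in> T"
      by (force simp: T_def)
    then show "R j (map (eval ?A ((!) fs) e) ts) = rel_of ?A j (map (eval ?A ((!) fs) e) ts)"
      using t(2) by (auto simp: R_def)
  qed
  then have "card (sat_assignments ?B ars l (foldr All ys \<psi>)) > 0"
    using finite_sat_assignments card_gt_0_iff by blast
  moreover have "is_struct \<sigma> ?B"
    using n(3) by (simp add: is_struct_def)
  moreover have "False \<in> set (enc \<sigma> ?B)"
    using i(1) t(1) by (intro False_in_enc[of i _ t]) (auto simp: R_def)
  ultimately show False
    using eq[of ?B] sep[of ?B] by simp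
qed

theorem theorem7:
  fixes k :: nat and with_max :: bool
  assumes "k \<ge> 1" and "k = 1 \<Longrightarrow> with_max"
  shows "sharp_Pi1 with_max k \<subset> sharp_Pi1 with_max (k + 1)"
proof -
  have "sharp_Pi1 with_max k \<subseteq> sharp_Pi1 with_max (k + 1)"
    unfolding sharp_Pi1_def by (fastforce intro: le_SucI)
  then show ?thesis
    using sep_fun_in sep_fun_notin[OF assms(1)] by blast
qed

end
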